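(* Let $f\in C_0^\infty(\mathbb{R}^2)$ be radial. Then the linearized map $\delta X_{0,f}$ (at $a=0$) has an infinite dimensional kernel, including all radial pairs $(\delta a,\delta f)$ with $\delta a$ a smooth function of compact support, and $\delta f$ given by $$\delta f(r)=-\frac1\pi\int_r^\infty(p^2-r^2)^{-1/2}\,\frac{d}{dp}\,I_{JBf}\delta a(p\omega,\omega^\perp)\,dp,$$ where $r=|x|$ and $I_{JBf}\delta a(p\omega,\omega^\perp)$ is independent of $\omega\in S^1$.
   Context: Notation: $v^\perp=(-v_2,v_1)$. For $x\in\mathbb{R}^2$, $\theta\in S^1$: $Ba(x,\theta)=\int_0^\infty a(x+t\theta)\,dt$; $X_af(x,\theta)=\int_{\mathbb{R}}e^{-Ba(x+t\theta,\theta)}f(x+t\theta)\,dt$; for a weight $w(x,\theta)$, $I_wh(x,\theta)=\int_{\mathbb{R}}w(x+t\theta,\theta)h(x+t\theta)\,dt$; $Jh(x,\theta)=h(x,-\theta)$, so $JBf(x,\theta)=\int_{-\infty}^0f(x+t\theta)\,dt$. The linearization at $(0,f)$ of the map $(a,f)\mapsto X_af$ is $\delta X_{0,f}(\delta a,\delta f)=-I_{JBf}\,\delta a+X_0\,\delta f$, where $X_0h(x,\theta)=\int_{\mathbb{R}}h(x+t\theta)\,dt$. A radial function $h$ on $\mathbb{R}^2$ is identified with a function $h(r)$ of $r=|x|$. *)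

theory Defs
  imports "HOL-Analysis.Analysis" "HOL-Library.Function_Algebras"
begin

type_synonym plane = "real ^ 2"

definition perp :: "plane \<Rightarrow> plane" where
  "perp v = vector [- (v $ 2), v $ 1]"

primrec C_diff :: "nat \<Rightarrow> ('a::real_normed_vector \<Rightarrow> real) \<Rightarrow> bool" where
  "C_diff 0 h \<longleftrightarrow> continuous_on UNIV h"
| "C_diff (Suc k) h \<longleftrightarrow>
     (\<forall>x. h differentiable (at x)) \<and> (\<forall>v. C_diff k (\<lambda>x. frechet_derivative h (at x) v))"

text \<open>The space of smooth, compactly supported functions; all functions are real-valued.\<close>

definition test_functions :: "('a::real_normed_vector \<Rightarrow> real) set" where
  "test_functions = {h. (\<forall>k. C_diff k h) \<and> compact (closure {x. h x \<noteq> 0})}"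

definition radial :: "('a::real_normed_vector \<Rightarrow> real) \<Rightarrow> bool" where
  "radial h \<longleftrightarrow> (\<exists>H. \<forall>x. h x = H (norm x))"

text \<open>Directions are points of the plane; they are restricted to the unit circle
  where the functions below are compared.\<close>

definition beam :: "(plane \<Rightarrow> real) \<Rightarrow> plane \<Rightarrow> plane \<Rightarrow> real" where
  "beam a x \<theta> = (LINT t:{0..}|lborel. a (x + t *\<^sub>R \<theta>))"

definition attenuated_xray :: "(plane \<Rightarrow> real) \<Rightarrow> (plane \<Rightarrow> real) \<Rightarrow> plane \<Rightarrow> plane \<Rightarrow> real" where
  "attenuated_xray a f x \<theta> =
     (LINT t|lborel. exp (- beam a (x + t *\<^sub>R \<theta>) \<theta>) * f (x + t *\<^sub>R \<theta>))"

definition weighted_xray ::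
    "(plane \<Rightarrow> plane \<Rightarrow> real) \<Rightarrow> (plane \<Rightarrow> real) \<Rightarrow> plane \<Rightarrow> plane \<Rightarrow> real" where
  "weighted_xray w h x \<theta> = (LINT t|lborel. w (x + t *\<^sub>R \<theta>) \<theta> * h (x + t *\<^sub>R \<theta>))"

definition flip :: "(plane \<Rightarrow> plane \<Rightarrow> real) \<Rightarrow> plane \<Rightarrow> plane \<Rightarrow> real" where
  "flip h x \<theta> = h x (- \<theta>)"

text \<open>The linearization of the attenuated transform in (attenuation, source) at \<open>(0, f)\<close>.\<close>

definition linearized_xray ::
    "(plane \<Rightarrow> real) \<Rightarrow> (plane \<Rightarrow> real) \<times> (plane \<Rightarrow> real) \<Rightarrow> plane \<Rightarrow> plane \<Rightarrow> real" where
  "linearized_xray f = (\<lambda>(da, df) x \<theta>.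
     - weighted_xray (flip (beam f)) da x \<theta> + attenuated_xray (\<lambda>_. 0) df x \<theta>)"

lemma attenuated_xray_0: "attenuated_xray (\<lambda>_. 0) h x \<theta> = (LINT t|lborel. h (x + t *\<^sub>R \<theta>))"
  by (simp add: attenuated_xray_def beam_def set_lebesgue_integral_def)

definition linearized_kernel ::
    "(plane \<Rightarrow> real) \<Rightarrow> ((plane \<Rightarrow> real) \<times> (plane \<Rightarrow> real)) set" where
  "linearized_kernel f = {u \<in> test_functions \<times> test_functions.
     \<forall>x. \<forall>\<theta> \<in> sphere 0 1. linearized_xray f u x \<theta> = 0}"

text \<open>Pairs of functions as a real vector space; the library makes function spaces additive
  groups but does not provide scalar multiplication on them.\<close>

definition scale_pair ::
    "real \<Rightarrow> ('a \<Rightarrow> real) \<times> ('b \<Rightarrow> real) \<Rightarrow> ('a \<Rightarrow> real) \<times> ('b \<Rightarrow> real)" where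
  "scale_pair c u = ((\<lambda>x. c * fst u x), (\<lambda>x. c * snd u x))"

interpretation fun_pair: vector_space scale_pair
  by unfold_locales (auto simp: scale_pair_def fun_eq_iff algebra_simps)

definition infinite_dimensional :: "(('a \<Rightarrow> real) \<times> ('b \<Rightarrow> real)) set \<Rightarrow> bool" where
  "infinite_dimensional V \<longleftrightarrow> \<not> (\<exists>B. finite B \<and> V \<subseteq> fun_pair.span B)"

text \<open>The transform of \<open>da\<close> with the weight \<open>flip (beam f)\<close>, on the line at signed distance
  \<open>p\<close> from the origin with normal \<open>\<omega>\<close>.\<close>

definition line_data :: "(plane \<Rightarrow> real) \<Rightarrow> (plane \<Rightarrow> real) \<Rightarrow> plane \<Rightarrow> real \<Rightarrow> real" where
  "line_data f da \<omega> p = weighted_xray (flip (beam f)) da (p *\<^sub>R \<omega>) (perp \<omega>)"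

definition abel_integrand ::
    "(plane \<Rightarrow> real) \<Rightarrow> (plane \<Rightarrow> real) \<Rightarrow> plane \<Rightarrow> real \<Rightarrow> real \<Rightarrow> real" where
  "abel_integrand f da \<omega> r p = (p\<^sup>2 - r\<^sup>2) powr (- 1 / 2) * deriv (line_data f da \<omega>) p"

definition source_perturbation ::
    "(plane \<Rightarrow> real) \<Rightarrow> (plane \<Rightarrow> real) \<Rightarrow> plane \<Rightarrow> plane \<Rightarrow> real" where
  "source_perturbation f da \<omega> x =
     - (1 / pi) * (LINT p:{norm x<..}|lborel. abel_integrand f da \<omega> (norm x) p)"

end

theory Submission
  imports Defs
begin

text \<open>
  Fix radial \<open>f\<close> and \<open>\<delta>a\<close> and write their restrictions to a line at distance \<open>p\<close> from the origin
  as functions of the arc length \<open>t\<close> measured from the point of the line closest to the origin.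
  Both restrictions are even in \<open>t\<close>. The weight \<open>JBf\<close> at \<open>t\<close> is the integral of \<open>f\<close> over the half of
  the line behind \<open>t\<close>, and by evenness its values at \<open>t\<close> and \<open>-t\<close> add up to the integral of \<open>f\<close>
  over the entire line. Averaging over \<open>t \<mapsto> -t\<close> therefore replaces the weight by the constant
  \<open>X_0 f / 2\<close>: the weighted transform is half the product of the unweighted transforms of \<open>f\<close> and
  \<open>\<delta>a\<close> (\<open>half_line_weight_even\<close>, \<open>weighted_xray_radial\<close>). In particular it depends on \<open>p\<close> alone.

  What remains is to invert the X-ray transform on radial functions, keeping control of smoothness.
  All radial functions are written as \<open>\<phi>(|x|\<^sup>2)\<close>, where the profile \<open>\<phi>\<close> is smooth on the closed
  half line \<open>[0, \<infinity>)\<close>. A radial test function has such a profile by Whitney's theorem on even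
  functions (\<open>radial_test_function_profile\<close>), and a compactly supported profile gives a test function
  (\<open>radial_profile_test_function\<close>). On profiles, the X-ray transform is
  \<open>(X \<phi>)(s) = \<integral> \<phi>(s + t\<^sup>2) dt\<close>, evaluated at \<open>s = p\<^sup>2\<close>; it commutes with differentiation and hence
  preserves smoothness. So the weighted transform is \<open>\<gamma>(p\<^sup>2)\<close> for the profile \<open>\<gamma> = (X \<phi>)(X \<alpha>) / 2\<close>.
  The substitution \<open>p\<^sup>2 = r\<^sup>2 + u\<^sup>2\<close> removes the singularity of the Abel integral and shows that the
  source perturbation is \<open>-(1/\<pi>) (X \<gamma>')(r\<^sup>2)\<close> (\<open>abel_substitution\<close>), again a radial test function.
  Its X-ray transform is \<open>-(1/\<pi>) X X \<gamma>'\<close>, and since \<open>X X\<close> integrates a radial function over a plane,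
  polar coordinates give \<open>X X \<gamma>' = -\<pi> \<gamma>\<close> (\<open>xray_xray\<close>). The two terms of the linearization cancel.

  The kernel is infinite dimensional because \<open>\<delta>a\<close> may be any of infinitely many radial bump
  functions supported in disjoint annuli (\<open>infinite_dimensional_bumps\<close>).
\<close>

section \<open>Smooth functions of one variable\<close>

text \<open>
  Derivatives are taken within \<open>U\<close>, so that one-sided smoothness at \<open>0\<close> on \<open>{0..}\<close> is covered. With a
  coinductive definition, a family of functions consists of smooth functions as soon as it is
  closed under taking derivatives; no formula for the \<open>n\<close>-th derivative is needed.
\<close>

coinductive smooth_on :: "real set \<Rightarrow> (real \<Rightarrow> real) \<Rightarrow> bool" for U where
  smooth_onI: "(\<And>x. x \<in> U \<Longrightarrow> (F has_real_derivative F' x) (at x within U)) \<Longrightarrow>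
    smooth_on U F' \<Longrightarrow> smooth_on U F"

lemma smooth_onD:
  assumes "smooth_on U F"
  shows "\<exists>F'. (\<forall>x\<in>U. (F has_real_derivative F' x) (at x within U)) \<and> smooth_on U F'"
  using assms
proof cases
  case (smooth_onI F')
  then show ?thesis by (intro exI[of _ F']) simp
qed

lemma smooth_on_imp_continuous_on: "smooth_on U F \<Longrightarrow> continuous_on U F"
  using smooth_onD[of U F] by (auto intro: DERIV_continuous_on)

inductive sum_closure :: "((real \<Rightarrow> real) \<Rightarrow> bool) \<Rightarrow> (real \<Rightarrow> real) \<Rightarrow> bool" for X where
  sum_closure_base: "X F \<Longrightarrow> sum_closure X F"
| sum_closure_add: "sum_closure X F \<Longrightarrow> sum_closure X G \<Longrightarrow> sum_closure X (\<lambda>x. F x + G x)"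

text \<open>
  The product rule turns members of the family under consideration into sums of members. Since
  differentiation is additive, it is enough that derivatives stay in the family up to finite sums.
\<close>

lemma smooth_on_coinduct_upto_sums:
  assumes "X F"
    and step: "\<And>F. X F \<Longrightarrow>
      \<exists>F'. (\<forall>x\<in>U. (F has_real_derivative F' x) (at x within U)) \<and> sum_closure X F'"
  shows "smooth_on U F"
proof -
  have derivative: "\<exists>F'. (\<forall>x\<in>U. (F has_real_derivative F' x) (at x within U)) \<and> sum_closure X F'"
    if "sum_closure X F" for F
    using that
  proof (induction rule: sum_closure.induct)
    case (sum_closure_base F)
    then show ?case by (rule step)
  next
    case (sum_closure_add F G)
    obtain F' where "\<forall>x\<in>U. (F has_real_derivative F' x) (at x within U)" "sum_closure X F'"
      using sum_closure_add.IH(1) by (elim exE conjE)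
    moreover obtain G' where
      "\<forall>x\<in>U. (G has_real_derivative G' x) (at x within U)" "sum_closure X G'"
      using sum_closure_add.IH(2) by (elim exE conjE)
    ultimately have "\<forall>x\<in>U. ((\<lambda>x. F x + G x) has_real_derivative F' x + G' x) (at x within U)"
        and "sum_closure X (\<lambda>x. F' x + G' x)"
      by (blast intro: DERIV_add, intro sum_closure.sum_closure_add[of X F' G'])
    then show ?case by (intro exI[of _ "\<lambda>x. F' x + G' x"] conjI)
  qed
  show ?thesis
  proof (rule smooth_on.coinduct[of "sum_closure X", OF sum_closure_base[of X, OF assms(1)]])
    fix F assume "sum_closure X F"
    from derivative[OF this] obtain F' where
      "\<forall>x\<in>U. (F has_real_derivative F' x) (at x within U)" "sum_closure X F'"
      by (elim exE conjE)
    then show "\<exists>G F'. F = G \<and> (\<forall>x. x \<in> U \<longrightarrow> (G has_real_derivative F' x) (at x within U)) \<and>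
        (sum_closure X F' \<or> smooth_on U F')"
      by - (rule exI[of _ F], rule exI[of _ F'], simp)
  qed
qed

lemma smooth_on_cong:
  assumes "smooth_on U F" "\<And>x. x \<in> U \<Longrightarrow> F x = G x"
  shows "smooth_on U G"
proof -
  obtain F' where F': "\<forall>x\<in>U. (F has_real_derivative F' x) (at x within U)" "smooth_on U F'"
    using smooth_onD[OF assms(1)] by (elim exE conjE)
  have "(G has_real_derivative F' x) (at x within U)" if "x \<in> U" for x
    using has_derivative_transform[OF that _ F'(1)[rule_format, OF that, unfolded has_field_derivative_def], of G]
      assms(2) by (simp add: has_field_derivative_def)
  then show ?thesis using F'(2) by (rule smooth_onI)
qed

lemma smooth_on_mult:
  assumes "smooth_on U F" "smooth_on U G"
  shows "smooth_on U (\<lambda>x. F x * G x)"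
proof -
  let ?X = "\<lambda>P. \<exists>F G. P = (\<lambda>x. F x * G x) \<and> smooth_on U F \<and> smooth_on U G"
  have X: "?X (\<lambda>x. A x * B x)" if "smooth_on U A" "smooth_on U B" for A B
    by (rule exI[of _ A], rule exI[of _ B]) (simp add: that)
  show ?thesis
  proof (rule smooth_on_coinduct_upto_sums[of ?X, OF X[OF assms]])
    fix P assume "?X P"
    then obtain F G where P: "P = (\<lambda>x. F x * G x)" and F: "smooth_on U F" and G: "smooth_on U G"
      by blast
    obtain F' where F': "\<forall>x\<in>U. (F has_real_derivative F' x) (at x within U)" "smooth_on U F'"
      using smooth_onD[OF F] by (elim exE conjE)
    obtain G' where G': "\<forall>x\<in>U. (G has_real_derivative G' x) (at x within U)" "smooth_on U G'"
      using smooth_onD[OF G] by (elim exE conjE)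
    have "sum_closure ?X (\<lambda>x. F' x * G x + F x * G' x)"
      by (rule sum_closure_add[OF sum_closure_base[of ?X, OF X[OF F'(2) G]]
            sum_closure_base[of ?X, OF X[OF F G'(2)]]])
    moreover have "\<forall>x\<in>U. (P has_real_derivative F' x * G x + F x * G' x) (at x within U)"
      unfolding P by (auto intro!: derivative_eq_intros F'(1)[rule_format] G'(1)[rule_format])
    ultimately show "\<exists>P'. (\<forall>x\<in>U. (P has_real_derivative P' x) (at x within U)) \<and> sum_closure ?X P'"
      by (intro exI[of _ "\<lambda>x. F' x * G x + F x * G' x"]) simp
  qed
qed

lemma smooth_on_const: "smooth_on U (\<lambda>_. c)"
proof -
  have "\<exists>d. (\<lambda>_::real. c) = (\<lambda>_. d)" by blast
  then show ?thesis
  proof (rule smooth_on_coinduct_upto_sums[of "\<lambda>P. \<exists>d. P = (\<lambda>_. d)"])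
    fix P :: "real \<Rightarrow> real" assume "\<exists>d. P = (\<lambda>_. d)"
    then have "\<forall>x\<in>U. (P has_real_derivative 0) (at x within U)" by auto
    moreover have "sum_closure (\<lambda>P. \<exists>d. P = (\<lambda>_. d)) (\<lambda>_. 0)"
      by (rule sum_closure_base[of "\<lambda>P. \<exists>d. P = (\<lambda>_. d)"]) (rule exI, rule refl)
    ultimately show "\<exists>P'. (\<forall>x\<in>U. (P has_real_derivative P' x) (at x within U)) \<and>
        sum_closure (\<lambda>P. \<exists>d. P = (\<lambda>_. d)) P'" by (intro exI[of _ "\<lambda>_. 0"]) simp
  qed
qed

lemma smooth_on_cmult: "smooth_on U F \<Longrightarrow> smooth_on U (\<lambda>x. c * F x)"
  by (intro smooth_on_mult smooth_on_const)

lemma smooth_on_compose_affine: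
  assumes "smooth_on UNIV F"
  shows "smooth_on U (\<lambda>x. F (a * x + b))"
proof -
  let ?X = "\<lambda>P. \<exists>c F. P = (\<lambda>x. c * F (a * x + b)) \<and> smooth_on UNIV F"
  have X: "?X (\<lambda>x. c * F (a * x + b))" if "smooth_on UNIV F" for c F
    by (rule exI[of _ c], rule exI[of _ F]) (simp add: that)
  have "smooth_on U (\<lambda>x. 1 * F (a * x + b))"
  proof (rule smooth_on_coinduct_upto_sums[of ?X, OF X[OF assms]])
    fix P assume "?X P"
    then obtain c F where P: "P = (\<lambda>x. c * F (a * x + b))" and F: "smooth_on UNIV F"
      by blast
    obtain F' where F': "\<forall>x. (F has_real_derivative F' x) (at x)" "smooth_on UNIV F'"
      using smooth_onD[OF F] by (elim exE conjE) simp
    have "(P has_real_derivative (c * a) * F' (a * x + b)) (at x within U)" for x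
      unfolding P
      by (rule DERIV_cong[OF DERIV_cmult[OF DERIV_chain2[OF F'(1)[rule_format] DERIV_add[OF DERIV_cmult_Id DERIV_const]]]])
        simp
    moreover have "sum_closure ?X (\<lambda>x. (c * a) * F' (a * x + b))"
      by (rule sum_closure_base[of ?X, OF X[OF F'(2)]])
    ultimately show "\<exists>P'. (\<forall>x\<in>U. (P has_real_derivative P' x) (at x within U)) \<and> sum_closure ?X P'"
      by (intro exI[of _ "\<lambda>x. (c * a) * F' (a * x + b)"]) simp
  qed
  then show ?thesis by simp
qed

section \<open>Profiles of radial functions\<close>

text \<open>
  The function \<open>\<phi>\<close> such that a compactly supported smooth radial function is \<open>x \<mapsto> \<phi>(|x|\<^sup>2)\<close>. With
  \<open>|x|\<close> in place of its square, smoothness of the radial function would require all odd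
  derivatives at \<open>0\<close> to vanish.
\<close>

definition profile :: "(real \<Rightarrow> real) \<Rightarrow> bool" where
  "profile \<phi> \<longleftrightarrow> smooth_on {0..} \<phi> \<and> (\<exists>M. \<forall>s\<ge>M. \<phi> s = 0)"

lemma profile_continuous_on: "profile \<phi> \<Longrightarrow> continuous_on {0..} \<phi>"
  by (simp add: profile_def smooth_on_imp_continuous_on)

lemma profile_vanishing_bound:
  assumes "profile \<phi>"
  shows "\<exists>M>0. \<forall>s\<ge>M. \<phi> s = 0"
proof -
  obtain M where "\<forall>s\<ge>M. \<phi> s = 0" using assms by (auto simp: profile_def)
  then show ?thesis by (intro exI[of _ "max M 1"]) auto
qed

lemma profile_derivative:
  assumes "profile \<phi>"
  shows "\<exists>\<phi>'. profile \<phi>' \<and> (\<forall>s\<ge>0. (\<phi> has_real_derivative \<phi>' s) (at s within {0..}))"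
proof -
  have "smooth_on {0..} \<phi>"
    using assms by (simp add: profile_def)
  from smooth_onD[OF this, unfolded Ball_def atLeast_iff]
  obtain \<phi>' where \<phi>': "\<forall>s\<ge>0. (\<phi> has_real_derivative \<phi>' s) (at s within {0..})"
      and sm: "smooth_on {0..} \<phi>'"
    by (elim conjE exE)
  obtain M where M: "M > 0" "\<forall>s\<ge>M. \<phi> s = 0"
    using profile_vanishing_bound[OF assms] by blast
  \<comment> \<open>For \<open>s > M\<close> the derivative is two-sided, hence unique.\<close>
  have "\<phi>' s = 0" if s: "s \<ge> M + 1" for s
  proof -
    have pos: "s > 0" using s M(1) by linarith
    then have "(\<phi> has_real_derivative \<phi>' s) (at s)"
      using \<phi>'[rule_format, of s] at_within_interior[of s "{0..}"] by simp
    moreover have "(\<phi> has_real_derivative 0) (at s)"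
      by (rule has_field_derivative_transform_within_open[of "\<lambda>_. 0" 0 s "{M<..}"]) (use s M(2) in auto)
    ultimately show ?thesis by (rule DERIV_unique)
  qed
  then have "profile \<phi>'" using sm unfolding profile_def by blast
  with \<phi>' show ?thesis by (intro exI[of _ \<phi>'] conjI)
qed

lemma profile_mult: "profile \<phi> \<Longrightarrow> profile \<psi> \<Longrightarrow> profile (\<lambda>s. \<phi> s * \<psi> s)"
  unfolding profile_def by (intro conjI smooth_on_mult) (blast, blast, metis mult_zero_left)

lemma profile_cmult: "profile \<phi> \<Longrightarrow> profile (\<lambda>s. c * \<phi> s)"
  unfolding profile_def by (intro conjI smooth_on_cmult) (blast, metis mult_zero_right)

text \<open>
  The outer function is differentiable only from within \<open>{0..}\<close>; this is enough because \<open>q\<close> never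
  leaves this set, even where it touches its boundary point \<open>0\<close>.
\<close>

lemma has_derivative_compose_nonneg:
  assumes "\<And>s. (0::real) \<le> s \<Longrightarrow> (\<phi> has_real_derivative \<phi>' s) (at s within {0..})"
    and "(q has_derivative q') (at x)" "\<And>y. q y \<ge> (0::real)"
  shows "((\<lambda>y. \<phi> (q y)) has_derivative (\<lambda>v. \<phi>' (q x) * q' v)) (at x)"
proof -
  have "(\<phi> has_derivative (*) (\<phi>' (q x))) (at (q x) within {0..})"
    using assms(1)[OF assms(3)] unfolding has_field_derivative_def .
  moreover have "q ` UNIV \<subseteq> {0..}" using assms(3) by blast
  ultimately have "(\<phi> has_derivative (*) (\<phi>' (q x))) (at (q x) within q ` UNIV)"
    by (rule has_derivative_subset)
  from has_derivative_in_compose[OF assms(2) this] show ?thesis .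
qed

section \<open>Radial test functions and their profiles\<close>

lemma C_diff_SucI:
  assumes "\<And>x. (h has_derivative h' x) (at x)" "\<And>v. C_diff k (\<lambda>x. h' x v)"
  shows "C_diff (Suc k) h"
proof -
  have "frechet_derivative h (at x) = h' x" for x
    using frechet_derivative_at[OF assms(1)[of x]] by simp
  then show ?thesis
    using assms by (auto simp: differentiable_def)
qed

lemma C_diff_Suc_has_derivative:
  "C_diff (Suc k) h \<Longrightarrow> (h has_derivative frechet_derivative h (at x)) (at x)"
  by (simp flip: frechet_derivative_works)

lemma C_diff_Suc_imp: "C_diff (Suc k) h \<Longrightarrow> C_diff k h"
proof (induction k arbitrary: h)
  case 0
  then have "continuous (at x) h" for x
    using differentiable_imp_continuous_within[of h x UNIV] by simp
  then show ?case by (simp add: continuous_at_imp_continuous_on)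
next
  case (Suc k)
  then show ?case by (metis C_diff.simps(2))
qed

lemma C_diff_const: "C_diff k (\<lambda>_. c)"
proof (induction k arbitrary: c)
  case (Suc k)
  show ?case by (rule C_diff_SucI[where h' = "\<lambda>_ _. 0"]) (auto intro: Suc)
qed simp

lemma C_diff_bounded_linear:
  assumes "bounded_linear h"
  shows "C_diff k h"
proof (cases k)
  case 0
  then show ?thesis
    using assms by (simp add: linear_continuous_on)
next
  case (Suc j)
  show ?thesis
    unfolding Suc
    by (rule C_diff_SucI[where h' = "\<lambda>_. h"]) (auto intro: C_diff_const bounded_linear_imp_has_derivative[OF assms])
qed

lemma C_diff_add: "C_diff k g \<Longrightarrow> C_diff k h \<Longrightarrow> C_diff k (\<lambda>x. g x + h x)"
proof (induction k arbitrary: g h)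
  case 0
  then show ?case by (simp add: continuous_on_add)
next
  case (Suc k)
  show ?case
    by (rule C_diff_SucI[OF has_derivative_add[OF Suc.prems[THEN C_diff_Suc_has_derivative]] Suc.IH])
      (use Suc.prems in auto)
qed

lemma C_diff_mult: "C_diff k g \<Longrightarrow> C_diff k h \<Longrightarrow> C_diff k (\<lambda>x. g x * h x)"
proof (induction k arbitrary: g h)
  case 0
  then show ?case by (simp add: continuous_on_mult)
next
  case (Suc k)
  show ?case
    by (rule C_diff_SucI[OF has_derivative_mult[OF Suc.prems[THEN C_diff_Suc_has_derivative]]],
        intro C_diff_add Suc.IH)
      (use Suc.prems Suc.prems[THEN C_diff_Suc_imp] in auto)
qed

text \<open>
  The derivative of \<open>\<phi>(|x|\<^sup>2)\<close> in direction \<open>v\<close> is \<open>2 \<phi>'(|x|\<^sup>2) (v \<bullet> x)\<close>, a linear function times a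
  function of the same kind.
\<close>

lemma C_diff_radial:
  fixes \<phi> :: "real \<Rightarrow> real"
  assumes "smooth_on {0..} \<phi>"
  shows "C_diff k (\<lambda>x :: 'a :: real_inner. \<phi> ((norm x)\<^sup>2))"
  using assms
proof (induction k arbitrary: \<phi>)
  case 0
  have "continuous_on UNIV (\<lambda>x :: 'a. \<phi> ((norm x)\<^sup>2))"
    by (rule continuous_on_compose2[OF smooth_on_imp_continuous_on[OF 0]]) (auto intro!: continuous_intros)
  then show ?case by simp
next
  case (Suc k)
  obtain \<phi>' where \<phi>': "\<forall>s\<in>{0..}. (\<phi> has_real_derivative \<phi>' s) (at s within {0..})" "smooth_on {0..} \<phi>'"
    using smooth_onD[OF Suc.prems] by (elim exE conjE)
  have square: "((\<lambda>x :: 'a. (norm x)\<^sup>2) has_derivative (\<lambda>v. 2 * (v \<bullet> x))) (at x)" for x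
    unfolding power2_norm_eq_inner
    by (rule derivative_eq_intros refl)+ (simp add: inner_commute)
  show ?case
  proof (rule C_diff_SucI)
    show "((\<lambda>x :: 'a. \<phi> ((norm x)\<^sup>2)) has_derivative (\<lambda>v. \<phi>' ((norm x)\<^sup>2) * (2 * (v \<bullet> x)))) (at x)" for x
      by (rule has_derivative_compose_nonneg[OF _ square]) (use \<phi>'(1) in auto)
    show "C_diff k (\<lambda>x :: 'a. \<phi>' ((norm x)\<^sup>2) * (2 * (v \<bullet> x)))" for v
      by (intro C_diff_mult Suc.IH[OF \<phi>'(2)] C_diff_const C_diff_bounded_linear bounded_linear_inner_right)
  qed
qed

lemma radial_profile_test_function:
  assumes "profile \<phi>"
  shows "(\<lambda>x :: 'a :: euclidean_space. \<phi> ((norm x)\<^sup>2)) \<in> test_functions"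
proof -
  obtain M where M: "\<forall>s\<ge>M. \<phi> s = 0"
    using assms by (auto simp: profile_def)
  have "norm x \<le> sqrt M" if "\<phi> ((norm x)\<^sup>2) \<noteq> 0" for x :: 'a
    using M that by (intro real_le_rsqrt) (meson le_cases)
  then have "bounded {x :: 'a. \<phi> ((norm x)\<^sup>2) \<noteq> 0}"
    by (auto simp: bounded_iff)
  then show ?thesis
    using assms by (simp add: test_functions_def profile_def C_diff_radial)
qed

lemma smooth_on_line:
  assumes "\<forall>k. C_diff k h"
  shows "smooth_on UNIV (\<lambda>t. h (t *\<^sub>R e))"
proof -
  let ?X = "\<lambda>P. \<exists>h. P = (\<lambda>t. h (t *\<^sub>R e)) \<and> (\<forall>k. C_diff k h)"
  have X: "?X (\<lambda>t. g (t *\<^sub>R e))" if "\<forall>k. C_diff k g" for g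
    by (rule exI[of _ g]) (simp add: that)
  show ?thesis
  proof (rule smooth_on_coinduct_upto_sums[of ?X, OF X[OF assms]])
    fix P assume "?X P"
    then obtain g where P: "P = (\<lambda>t. g (t *\<^sub>R e))" and g: "\<forall>k. C_diff k g" by (elim exE conjE)
    define g' where "g' x = frechet_derivative g (at x) e" for x
    have g': "\<forall>k. C_diff k g'"
      using g unfolding g'_def by (metis C_diff.simps(2))
    have "(P has_real_derivative g' (t *\<^sub>R e)) (at t)" for t
    proof -
      have D: "(g has_derivative frechet_derivative g (at (t *\<^sub>R e))) (at (t *\<^sub>R e))"
        using g C_diff_Suc_has_derivative by blast
      have "(P has_derivative (\<lambda>u. frechet_derivative g (at (t *\<^sub>R e)) (u *\<^sub>R e))) (at t)"
        unfolding P
        by (rule has_derivative_compose[of "\<lambda>t. t *\<^sub>R e" "\<lambda>u. u *\<^sub>R e", OF _ D])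
          (auto intro!: derivative_eq_intros)
      moreover have "(\<lambda>u. frechet_derivative g (at (t *\<^sub>R e)) (u *\<^sub>R e)) = (*) (g' (t *\<^sub>R e))"
        using linear_scale[OF has_derivative_linear[OF D]] by (simp add: g'_def fun_eq_iff)
      ultimately show ?thesis
        by (simp add: has_field_derivative_def)
    qed
    moreover have "sum_closure ?X (\<lambda>t. g' (t *\<^sub>R e))"
      by (rule sum_closure_base[of ?X, OF X[OF g']])
    ultimately show "\<exists>P'. (\<forall>x\<in>UNIV. (P has_real_derivative P' x) (at x)) \<and> sum_closure ?X P'"
      by (intro exI[of _ "\<lambda>t. g' (t *\<^sub>R e)"] conjI ballI)
  qed
qed

text \<open>
  Differentiating under the integral sign produces a factor \<open>\<tau>\<close>, so the family closed under
  derivatives is \<open>\<integral> \<tau>\<^sup>j F(\<tau> x) d\<tau>\<close> for all \<open>j\<close>.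
\<close>

lemma smooth_on_mean:
  assumes "smooth_on UNIV F"
  shows "smooth_on UNIV (\<lambda>x. integral {0..1} (\<lambda>\<tau>. F (\<tau> * x)))"
proof -
  define mean where "mean j F x = integral {0..1} (\<lambda>\<tau>. \<tau> ^ j * F (\<tau> * x))"
    for j and F :: "real \<Rightarrow> real" and x :: real
  let ?X = "\<lambda>P. \<exists>j F. P = mean j F \<and> smooth_on UNIV F"
  have X: "?X (mean j F)" if "smooth_on UNIV F" for j F
    by (rule exI[of _ j], rule exI[of _ F]) (simp add: that)
  have "smooth_on UNIV (mean 0 F)"
  proof (rule smooth_on_coinduct_upto_sums[of ?X, OF X[OF assms]])
    fix P assume "?X P"
    then obtain j F where P: "P = mean j F" and F: "smooth_on UNIV F" by (elim exE conjE)
    obtain F' where F': "\<forall>x\<in>UNIV. (F has_real_derivative F' x) (at x)" "smooth_on UNIV F'"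
      using smooth_onD[OF F] by (elim exE conjE)
    have cont: "continuous_on S (\<lambda>z. G (g z))"
      if "smooth_on UNIV G" "continuous_on S g" for G and g :: "'b::topological_space \<Rightarrow> real" and S
      by (rule continuous_on_compose2[OF smooth_on_imp_continuous_on[OF that(1)] that(2)]) simp
    have "((\<lambda>x. integral (cbox 0 1) (\<lambda>\<tau>. \<tau> ^ j * F (\<tau> * x))) has_real_derivative
        integral (cbox 0 1) (\<lambda>\<tau>. \<tau> ^ Suc j * F' (\<tau> * x))) (at x within UNIV)" for x
    proof (rule leibniz_rule_field_derivative)
      show "((\<lambda>x. \<tau> ^ j * F (\<tau> * x)) has_real_derivative \<tau> ^ Suc j * F' (\<tau> * x)) (at x within UNIV)" for x \<tau>
        by (rule DERIV_cong[OF DERIV_cmult[OF DERIV_chain2[OF F'(1)[rule_format, OF UNIV_I] DERIV_cmult_Id]]]) simp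
      show "(\<lambda>\<tau>. \<tau> ^ j * F (\<tau> * x)) integrable_on cbox 0 1" for x
        by (intro integrable_continuous continuous_intros cont[OF F])
      show "continuous_on (UNIV \<times> cbox 0 1) (\<lambda>(x, \<tau>). \<tau> ^ Suc j * F' (\<tau> * x))"
        unfolding split_beta by (intro continuous_intros cont[OF F'(2)])
    qed auto
    then have "\<forall>x\<in>UNIV. (P has_real_derivative mean (Suc j) F' x) (at x)"
      by (simp add: P mean_def[abs_def])
    moreover have "sum_closure ?X (mean (Suc j) F')"
      by (rule sum_closure_base[of ?X, OF X[OF F'(2)]])
    ultimately show "\<exists>P'. (\<forall>x\<in>UNIV. (P has_real_derivative P' x) (at x)) \<and> sum_closure ?X P'"
      by (intro exI[of _ "mean (Suc j) F'"] conjI)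
  qed
  then show ?thesis by (simp add: mean_def[abs_def])
qed

text \<open>
  The operator \<open>F \<mapsto> F'(x) / x\<close> preserves even smooth functions. As \<open>F'\<close> is odd, \<open>F'(0) = 0\<close>, and the
  fundamental theorem of calculus along \<open>\<tau> \<mapsto> \<tau> x\<close> gives \<open>F'(x) = x \<integral> F''(\<tau> x) d\<tau>\<close> with \<open>\<tau>\<close> in \<open>{0..1}\<close>.
  This Hadamard form shows that the quotient is smooth at \<open>0\<close>.
\<close>

lemma even_derivative:
  assumes "smooth_on UNIV F" "\<forall>x. F (- x) = F x"
  shows "\<exists>E. smooth_on UNIV E \<and> (\<forall>x. E (- x) = E x) \<and> (\<forall>x. (F has_real_derivative x * E x) (at x))"
proof -
  obtain F' where F': "\<forall>x\<in>UNIV. (F has_real_derivative F' x) (at x)" "smooth_on UNIV F'"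
    using smooth_onD[OF assms(1)] by (elim exE conjE)
  obtain F'' where F'': "\<forall>x\<in>UNIV. (F' has_real_derivative F'' x) (at x)" "smooth_on UNIV F''"
    using smooth_onD[OF F'(2)] by (elim exE conjE)
  have odd: "F' (- x) = - F' x" for x
  proof -
    have "((\<lambda>x. F (- x)) has_real_derivative - F' (- x)) (at x)"
      by (rule DERIV_cong[OF DERIV_chain2[OF F'(1)[rule_format, OF UNIV_I] DERIV_minus[OF DERIV_ident]]]) simp
    then have "(F has_real_derivative - F' (- x)) (at x)"
      using assms(2) by simp
    then show ?thesis
      using DERIV_unique F'(1) by fastforce
  qed
  define E where "E x = integral {0..1} (\<lambda>\<tau>. F'' (\<tau> * x))" for x
  have E: "F' x = x * E x" for x
  proof -
    have "((\<lambda>\<tau>. x * F'' (\<tau> * x)) has_integral F' (1 * x) - F' (0 * x)) {0..1}"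
    proof (rule fundamental_theorem_of_calculus)
      show "((\<lambda>\<tau>. F' (\<tau> * x)) has_vector_derivative x * F'' (\<tau> * x)) (at \<tau> within {0..1})" for \<tau>
        unfolding has_real_derivative_iff_has_vector_derivative[symmetric]
        by (rule DERIV_cong[OF DERIV_chain2[OF F''(1)[rule_format, OF UNIV_I] DERIV_cmult_right[OF DERIV_ident]]]) simp
    qed simp
    then have "integral {0..1} (\<lambda>\<tau>. x * F'' (\<tau> * x)) = F' (1 * x) - F' (0 * x)"
      by (rule integral_unique)
    then have "integral {0..1} (\<lambda>\<tau>. x * F'' (\<tau> * x)) = F' x"
      using odd[of 0] by simp
    then show ?thesis by (simp add: E_def)
  qed
  have "smooth_on UNIV E"
    unfolding E_def by (rule smooth_on_mean[OF F''(2)])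
  moreover have "E (- x) = E x" for x
    using odd[of x] E[of x] E[of "- x"] by (cases "x = 0") auto
  moreover have "(F has_real_derivative x * E x) (at x)" for x
    using F'(1) by (simp add: E)
  ultimately show ?thesis by (intro exI[of _ E] conjI allI)
qed

text \<open>
  Away from \<open>0\<close> this is the chain rule. The square root is not differentiable at \<open>0\<close>, but
  \<open>F(\<surd>s)\<close> is continuous there, so it is the integral of its derivative, whose integrand extends
  continuously to \<open>0\<close>.
\<close>

lemma sqrt_derivative:
  assumes F: "\<forall>x. (F has_real_derivative x * E x) (at x)" and E: "continuous_on UNIV E"
    and "s \<ge> 0"
  shows "((\<lambda>s. F (sqrt s)) has_real_derivative E (sqrt s) / 2) (at s within {0..})"
proof -
  let ?g = "\<lambda>\<sigma>. E (sqrt \<sigma>) / 2"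
  have contg: "continuous_on S ?g" for S
    by (intro continuous_intros continuous_on_compose2[OF E]) auto
  have contF: "continuous_on S (\<lambda>s. F (sqrt s))" for S
  proof (rule continuous_on_compose2[of UNIV F])
    show "continuous_on UNIV F"
      using F DERIV_isCont by (blast intro: continuous_at_imp_continuous_on)
  qed (auto intro!: continuous_intros)
  have FTC: "integral {0..r} ?g = F (sqrt r) - F 0" if "r \<ge> 0" for r
  proof -
    have "(?g has_integral F (sqrt r) - F (sqrt 0)) {0..r}"
    proof (rule fundamental_theorem_of_calculus_interior[OF that contF])
      fix \<sigma> :: real assume "\<sigma> \<in> {0<..<r}"
      then have pos: "\<sigma> > 0" by simp
      have "((\<lambda>s. F (sqrt s)) has_real_derivative ?g \<sigma>) (at \<sigma>)"
        by (rule DERIV_cong[OF DERIV_chain2[OF F[rule_format] DERIV_real_sqrt[OF pos]]])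
          (use pos in \<open>simp add: field_simps\<close>)
      then show "((\<lambda>s. F (sqrt s)) has_vector_derivative ?g \<sigma>) (at \<sigma>)"
        by (simp add: has_real_derivative_iff_has_vector_derivative)
    qed
    from integral_unique[OF this] show ?thesis by simp
  qed
  have "((\<lambda>r. integral {0..r} ?g + F 0) has_real_derivative ?g s + 0) (at s within {0..s + 1})"
    by (intro DERIV_add integral_has_real_derivative contg DERIV_const) (use \<open>s \<ge> 0\<close> in simp)
  then have "((\<lambda>r. integral {0..r} ?g + F 0) has_derivative (*) (?g s)) (at s within {0..s + 1})"
    by (simp add: has_field_derivative_def)
  then have "((\<lambda>r. F (sqrt r)) has_derivative (*) (?g s)) (at s within {0..s + 1})"
    by (rule has_derivative_transform[rotated 2]) (use \<open>s \<ge> 0\<close> FTC in \<open>auto simp: field_simps\<close>)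
  moreover have "at s within {0..s + 1} = at s within {0..}"
    by (rule at_within_nhd[of s "{..<s + 1}"]) auto
  ultimately show ?thesis by (simp add: has_field_derivative_def)
qed

text \<open>
  Whitney's theorem: an even smooth function is a smooth function of the square. Taking \<open>F(\<surd>s)\<close> to
  its derivative replaces \<open>F\<close> by half the function \<open>F'(x) / x\<close>, which is even and smooth again.
\<close>

lemma smooth_on_sqrt:
  assumes "smooth_on UNIV F" "\<forall>x. F (- x) = F x"
  shows "smooth_on {0..} (\<lambda>s. F (sqrt s))"
proof -
  let ?X = "\<lambda>P. \<exists>c F. P = (\<lambda>s. c * F (sqrt s)) \<and> smooth_on UNIV F \<and> (\<forall>x. F (- x) = F x)"
  have X: "?X (\<lambda>s. c * F (sqrt s))" if "smooth_on UNIV F" "\<forall>x. F (- x) = F x" for c F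
    by (rule exI[of _ c], rule exI[of _ F]) (simp add: that)
  have "smooth_on {0..} (\<lambda>s. 1 * F (sqrt s))"
  proof (rule smooth_on_coinduct_upto_sums[of ?X, OF X[OF assms]])
    fix P assume "?X P"
    then obtain c F where P: "P = (\<lambda>s. c * F (sqrt s))" and F: "smooth_on UNIV F" "\<forall>x. F (- x) = F x"
      by (elim exE conjE)
    obtain E where E: "smooth_on UNIV E" "\<forall>x. E (- x) = E x" "\<forall>x. (F has_real_derivative x * E x) (at x)"
      using even_derivative[OF F] by (elim exE conjE)
    have "\<forall>s\<in>{0..}. (P has_real_derivative c * (E (sqrt s) / 2)) (at s within {0..})"
      unfolding P atLeast_iff
      by (intro ballI DERIV_cmult sqrt_derivative[OF E(3) smooth_on_imp_continuous_on[OF E(1)]]) simp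
    moreover have "sum_closure ?X (\<lambda>s. (c / 2) * E (sqrt s))"
      by (rule sum_closure_base[of ?X, OF X[OF E(1,2)]])
    ultimately show "\<exists>P'. (\<forall>s\<in>{0..}. (P has_real_derivative P' s) (at s within {0..})) \<and> sum_closure ?X P'"
      by (intro exI[of _ "\<lambda>s. (c / 2) * E (sqrt s)"] conjI) simp_all
  qed
  then show ?thesis by simp
qed

text \<open>
  The restriction of a radial function to a line through the origin is even and determines it.
\<close>

lemma radial_test_function_profile:
  fixes h :: "'a :: euclidean_space \<Rightarrow> real"
  assumes "h \<in> test_functions" "radial h"
  shows "\<exists>\<phi>. profile \<phi> \<and> h = (\<lambda>x. \<phi> ((norm x)\<^sup>2))"
proof -
  obtain H where H: "h x = H (norm x)" for x
    using assms(2) unfolding radial_def by (elim exE) simp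
  obtain e :: 'a where e: "norm e = 1"
    using norm_Basis[OF SOME_Basis] by blast
  define F where "F t = h (t *\<^sub>R e)" for t
  have F: "F t = H \<bar>t\<bar>" for t
    by (simp add: F_def H e)
  have "\<forall>k. C_diff k h" and bdd: "bounded {x. h x \<noteq> 0}"
    using assms(1) by (auto simp: test_functions_def)
  then have "smooth_on UNIV F"
    unfolding F_def by (intro smooth_on_line)
  then have "smooth_on {0..} (\<lambda>s. F (sqrt s))"
    by (rule smooth_on_sqrt) (simp add: F)
  moreover have "\<exists>M. \<forall>s\<ge>M. F (sqrt s) = 0"
  proof -
    obtain B where B: "\<forall>x\<in>{x. h x \<noteq> 0}. norm x \<le> B"
      using bdd unfolding bounded_iff by (elim exE)
    have "F (sqrt s) = 0" if s: "s \<ge> (\<bar>B\<bar> + 1)\<^sup>2" for s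
    proof -
      have "\<bar>B\<bar> + 1 \<le> sqrt s" using s by (rule real_le_rsqrt)
      then have "\<not> norm (sqrt s *\<^sub>R e) \<le> B" by (simp add: e)
      then show ?thesis using B by (auto simp: F_def)
    qed
    then show ?thesis by blast
  qed
  ultimately have "profile (\<lambda>s. F (sqrt s))"
    by (simp add: profile_def)
  moreover have "h = (\<lambda>x. F (sqrt ((norm x)\<^sup>2)))"
    by (simp add: F H fun_eq_iff)
  ultimately show ?thesis by (intro exI[of _ "\<lambda>s. F (sqrt s)"] conjI)
qed

section \<open>The X-ray transform on profiles\<close>

lemma profile_derivative_shift:
  assumes "\<forall>s\<ge>0. (\<phi> has_real_derivative \<phi>' s) (at s within {0..})" "s \<ge> 0" "c \<ge> 0"
  shows "((\<lambda>s. \<phi> (s + c)) has_real_derivative \<phi>' (s + c)) (at s within {0..})"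
proof -
  have "(\<phi> has_real_derivative \<phi>' (s + c)) (at (s + c) within (\<lambda>s. s + c) ` {0..})"
    by (rule DERIV_subset[of _ _ _ "{0..}"]) (use assms in auto)
  moreover have "((\<lambda>s. s + c) has_real_derivative 1) (at s within {0..})"
    by (auto intro!: derivative_eq_intros)
  ultimately have "(\<phi> \<circ> (\<lambda>s. s + c) has_real_derivative \<phi>' (s + c) * 1) (at s within {0..})"
    by (rule DERIV_image_chain)
  then show ?thesis by (simp add: o_def)
qed

text \<open>
  If \<open>h(x) = \<phi>(|x|\<^sup>2)\<close>, this is the integral of \<open>h\<close> over any line whose squared distance from the
  origin is \<open>s\<close>.
\<close>

definition xray :: "(real \<Rightarrow> real) \<Rightarrow> real \<Rightarrow> real" where
  "xray \<phi> s = (LINT t|lborel. \<phi> (s + t\<^sup>2))"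

lemma square_ge_outside:
  fixes t :: real
  assumes "M > 0" "t \<notin> {- (M + 1)..M + 1}"
  shows "t\<^sup>2 \<ge> M"
proof -
  have "M + 1 \<le> \<bar>t\<bar>" using assms(2) by auto
  then have "(M + 1)\<^sup>2 \<le> t\<^sup>2"
    using power_mono[of "M + 1" "\<bar>t\<bar>" 2] assms(1) by simp
  moreover have "M \<le> (M + 1)\<^sup>2" using assms(1) by (simp add: power2_eq_square algebra_simps)
  ultimately show ?thesis by linarith
qed

lemma continuous_on_profile_compose:
  assumes "profile \<phi>" "continuous_on S g" "\<And>x. x \<in> S \<Longrightarrow> g x \<ge> 0"
  shows "continuous_on S (\<lambda>x. \<phi> (g x))"
  by (rule continuous_on_compose2[OF profile_continuous_on[OF assms(1)] assms(2)]) (use assms(3) in auto)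

lemma
  assumes "profile \<phi>" "M > 0" "\<forall>s\<ge>M. \<phi> s = 0" "s \<ge> 0"
  shows integrable_profile_bound: "integrable lborel (\<lambda>t. \<phi> (s + t\<^sup>2))"
    and xray_eq_integral: "xray \<phi> s = integral {- (M + 1)..M + 1} (\<lambda>t. \<phi> (s + t\<^sup>2))"
proof -
  let ?B = "{- (M + 1)..M + 1}"
  have cont: "continuous_on ?B (\<lambda>t. \<phi> (s + t\<^sup>2))"
    using assms(4) by (intro continuous_on_profile_compose[OF assms(1)] continuous_intros) simp
  have eq: "(\<lambda>t. indicator ?B t *\<^sub>R \<phi> (s + t\<^sup>2)) = (\<lambda>t. \<phi> (s + t\<^sup>2))"
  proof
    fix t
    show "indicator ?B t *\<^sub>R \<phi> (s + t\<^sup>2) = \<phi> (s + t\<^sup>2)"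
      using square_ge_outside[OF assms(2), of t] assms(3,4) by (cases "t \<in> ?B") auto
  qed
  have int: "integrable lborel (\<lambda>t. indicator ?B t *\<^sub>R \<phi> (s + t\<^sup>2))"
    by (rule borel_integrable_compact[OF compact_Icc cont])
  then show "integrable lborel (\<lambda>t. \<phi> (s + t\<^sup>2))"
    unfolding eq .
  have "set_integrable lborel ?B (\<lambda>t. \<phi> (s + t\<^sup>2))"
    using int unfolding set_integrable_def .
  from set_borel_integral_eq_integral(2)[OF this]
  show "xray \<phi> s = integral ?B (\<lambda>t. \<phi> (s + t\<^sup>2))"
    by (simp only: xray_def set_lebesgue_integral_def eq)
qed

lemma integrable_profile:
  assumes "profile \<phi>" "s \<ge> 0"
  shows "integrable lborel (\<lambda>t. \<phi> (s + t\<^sup>2))"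
  using profile_vanishing_bound[OF assms(1)] integrable_profile_bound[OF assms(1) _ _ assms(2)] by blast

lemma xray_has_derivative:
  assumes "profile \<phi>" "profile \<phi>'"
    and deriv: "\<forall>s\<ge>0. (\<phi> has_real_derivative \<phi>' s) (at s within {0..})" and "s \<ge> 0"
  shows "(xray \<phi> has_real_derivative xray \<phi>' s) (at s within {0..})"
proof -
  \<comment> \<open>A common bound turns both integrals into integrals over one fixed compact interval.\<close>
  obtain M1 M2 where M1: "M1 > 0" "\<forall>s\<ge>M1. \<phi> s = 0" and M2: "M2 > 0" "\<forall>s\<ge>M2. \<phi>' s = 0"
    using profile_vanishing_bound assms(1,2) by meson
  define M where "M = max M1 M2"
  have M: "M > 0" "\<forall>s\<ge>M. \<phi> s = 0" "\<forall>s\<ge>M. \<phi>' s = 0"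
    using M1 M2 by (auto simp: M_def)
  let ?B = "M + 1"
  have "((\<lambda>s. integral (cbox (- ?B) ?B) (\<lambda>t. \<phi> (s + t\<^sup>2))) has_real_derivative
      integral (cbox (- ?B) ?B) (\<lambda>t. \<phi>' (s + t\<^sup>2))) (at s within {0..})"
  proof (rule leibniz_rule_field_derivative)
    show "((\<lambda>s. \<phi> (s + t\<^sup>2)) has_real_derivative \<phi>' (s + t\<^sup>2)) (at s within {0..})"
      if "s \<in> {0..}" for s t
      using profile_derivative_shift[OF deriv, of s "t\<^sup>2"] that by simp
    show "(\<lambda>t. \<phi> (s + t\<^sup>2)) integrable_on cbox (- ?B) ?B" if "s \<in> {0..}" for s
      using that by (intro integrable_continuous continuous_on_profile_compose[OF assms(1)] continuous_intros) simp
    show "continuous_on ({0..} \<times> cbox (- ?B) ?B) (\<lambda>(s, t). \<phi>' (s + t\<^sup>2))"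
      unfolding split_beta
      by (intro continuous_on_profile_compose[OF assms(2)] continuous_intros) auto
  qed (use assms(4) in auto)
  then have "((\<lambda>s. integral {- ?B..?B} (\<lambda>t. \<phi> (s + t\<^sup>2))) has_derivative (*) (xray \<phi>' s)) (at s within {0..})"
    using xray_eq_integral[OF assms(2) M(1,3) assms(4)] by (simp add: has_field_derivative_def)
  then have "(xray \<phi> has_derivative (*) (xray \<phi>' s)) (at s within {0..})"
    by (rule has_derivative_transform[rotated 2])
      (use xray_eq_integral[OF assms(1) M(1,2)] assms(4) in auto)
  then show ?thesis by (simp add: has_field_derivative_def)
qed

text \<open>
  The transform commutes with differentiation of profiles, so transforms of profiles form a family
  closed under derivatives.
\<close>

lemma profile_xray:
  assumes "profile \<phi>"
  shows "profile (xray \<phi>)"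
proof -
  let ?X = "\<lambda>P. \<exists>\<phi>. P = xray \<phi> \<and> profile \<phi>"
  have X: "?X (xray \<psi>)" if "profile \<psi>" for \<psi>
    by (rule exI[of _ \<psi>]) (simp add: that)
  have "smooth_on {0..} (xray \<phi>)"
  proof (rule smooth_on_coinduct_upto_sums[of ?X, OF X[OF assms]])
    fix P assume "?X P"
    then obtain \<psi> where P: "P = xray \<psi>" and \<psi>: "profile \<psi>" by (elim exE conjE)
    obtain \<psi>' where \<psi>': "profile \<psi>'" "\<forall>s\<ge>0. (\<psi> has_real_derivative \<psi>' s) (at s within {0..})"
      using profile_derivative[OF \<psi>] by (elim exE conjE)
    have "\<forall>s\<in>{0..}. (P has_real_derivative xray \<psi>' s) (at s within {0..})"
      using xray_has_derivative[OF \<psi> \<psi>'] by (simp add: P)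
    moreover have "sum_closure ?X (xray \<psi>')"
      by (rule sum_closure_base[of ?X, OF X[OF \<psi>'(1)]])
    ultimately show "\<exists>P'. (\<forall>s\<in>{0..}. (P has_real_derivative P' s) (at s within {0..})) \<and> sum_closure ?X P'"
      by (intro exI[of _ "xray \<psi>'"] conjI)
  qed
  moreover have "\<exists>M. \<forall>s\<ge>M. xray \<phi> s = 0"
  proof -
    obtain M where M: "\<forall>s\<ge>M. \<phi> s = 0" using assms by (auto simp: profile_def)
    have "xray \<phi> s = 0" if "s \<ge> M" for s
    proof -
      have "\<phi> (s + t\<^sup>2) = 0" for t
        using M that zero_le_power2[of t] by (metis add_increasing2)
      then show ?thesis by (simp add: xray_def)
    qed
    then show ?thesis by blast
  qed
  ultimately show ?thesis by (simp add: profile_def)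
qed

text \<open>
  Polar coordinates in the form needed for radial integrands: the disc \<open>{y. |y|\<^sup>2 \<le> a}\<close> has area \<open>\<pi> a\<close>,
  so \<open>|y|\<^sup>2\<close> is distributed on \<open>{0..}\<close> with constant density \<open>\<pi>\<close>.
\<close>

lemma distr_lborel_norm_square:
  "distr (lborel :: (real \<times> real) measure) borel (\<lambda>y. (norm y)\<^sup>2) =
   density lborel (\<lambda>\<rho>. ennreal (pi * indicator {0..} \<rho>))" (is "?L = ?R")
proof (rule measure_eqI_generator_eq[where E = "range atMost" and \<Omega> = UNIV and A = "\<lambda>i. {..real i}"])
  have disc: "{y :: real \<times> real. (norm y)\<^sup>2 \<le> a} = cball 0 (sqrt a)" if "a \<ge> 0" for a
  proof -
    have "(norm y)\<^sup>2 \<le> a \<longleftrightarrow> norm y \<le> sqrt a" for y :: "real \<times> real"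
      using real_sqrt_le_iff[of "(norm y)\<^sup>2" a] by (simp del: real_sqrt_le_iff)
    then show ?thesis by auto
  qed
  have L: "emeasure ?L {..a} = ennreal (pi * a)" if "a \<ge> 0" for a
  proof -
    have "emeasure ?L {..a} = emeasure lborel (cball (0 :: real \<times> real) (sqrt a))"
      by (subst emeasure_distr) (auto simp flip: disc[OF that] simp: vimage_def)
    also have "\<dots> = ennreal (pi * a)"
      using that by (simp add: emeasure_cball unit_ball_vol_2)
    finally show ?thesis .
  qed
  have R: "emeasure ?R {..a} = ennreal (pi * max 0 a)" for a
  proof -
    have "emeasure ?R {..a} = (\<integral>\<^sup>+\<rho>. ennreal pi * indicator {0..a} \<rho> \<partial>lborel)"
      by (subst emeasure_density) (auto intro!: nn_integral_cong split: split_indicator)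
    also have "\<dots> = ennreal (pi * max 0 a)"
      by (subst nn_integral_cmult_indicator) (auto simp: ennreal_mult max_def)
    finally show ?thesis .
  qed
  have neg: "emeasure ?L {..a} = 0" if "a < 0" for a
  proof -
    have "(\<lambda>y :: real \<times> real. (norm y)\<^sup>2) -` {..a} = {}"
    proof -
      have "\<not> (norm y)\<^sup>2 \<le> a" for y :: "real \<times> real"
        using that zero_le_power2[of "norm y"] by linarith
      then show ?thesis by blast
    qed
    then show ?thesis by (subst emeasure_distr) auto
  qed
  show "emeasure ?L X = emeasure ?R X" if "X \<in> range atMost" for X
    using that by (auto simp: L neg R max_def not_le)
  show "emeasure ?L {..real i} \<noteq> \<infinity>" for i
    by (simp add: L)
  show "Int_stable (range atMost :: real set set)"
    by (auto simp: Int_stable_def)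
  show "sets ?L = sigma_sets UNIV (range atMost)" "sets ?R = sigma_sets UNIV (range atMost)"
    by (simp_all add: borel_eq_atMost)
  show "(\<Union>i. {..real i}) = UNIV"
    using real_arch_simple by auto
qed auto

text \<open>
  Abel inversion. Applying the transform twice integrates \<open>\<phi>'(s + |y|\<^sup>2)\<close> over all \<open>y\<close> in a plane. In
  the variable \<open>\<rho> = |y|\<^sup>2\<close> this is \<open>\<pi> \<integral> \<phi>'(s + \<rho>) d\<rho>\<close> over \<open>\<rho> \<ge> 0\<close>, and \<open>\<phi>\<close> vanishes at infinity.
\<close>

lemma xray_xray:
  assumes "profile \<phi>" "profile \<phi>'"
    and deriv: "\<forall>s\<ge>0. (\<phi> has_real_derivative \<phi>' s) (at s within {0..})" and "s \<ge> 0"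
  shows "xray (xray \<phi>') s = - pi * \<phi> s"
proof -
  obtain M1 M2 where M1: "M1 > 0" "\<forall>s\<ge>M1. \<phi> s = 0" and M2: "M2 > 0" "\<forall>s\<ge>M2. \<phi>' s = 0"
    using profile_vanishing_bound assms(1,2) by meson
  define M where "M = max M1 M2"
  have M: "M > 0" "\<forall>s\<ge>M. \<phi> s = 0" "\<forall>s\<ge>M. \<phi>' s = 0"
    using M1 M2 by (auto simp: M_def)
  \<comment> \<open>The absolute value makes the integrand continuous, hence measurable, on the entire line:
  nothing is known about \<open>\<phi>'\<close> at negative arguments.\<close>
  define G where "G \<rho> = \<phi>' (s + \<bar>\<rho>\<bar>)" for \<rho>
  have contG: "continuous_on S G" for S
    unfolding G_def using \<open>s \<ge> 0\<close>
    by (intro continuous_on_profile_compose[OF assms(2)] continuous_intros) simp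
  have Gm [measurable]: "G \<in> borel_measurable borel"
    using contG by (rule borel_measurable_continuous_onI)
  have eq: "(pi * indicator {0..} \<rho>) *\<^sub>R G \<rho> = pi * (indicator {0..M} \<rho> *\<^sub>R \<phi>' (s + \<rho>))" for \<rho>
    using M(3) \<open>s \<ge> 0\<close> by (auto simp: G_def split: split_indicator)
  have contM: "continuous_on {0..M} (\<lambda>\<rho>. \<phi>' (s + \<rho>))"
    using \<open>s \<ge> 0\<close> by (intro continuous_on_profile_compose[OF assms(2)] continuous_intros) simp
  have "integrable lborel (\<lambda>\<rho>. indicator {0..M} \<rho> *\<^sub>R \<phi>' (s + \<rho>))"
    by (rule borel_integrable_compact[OF compact_Icc contM])
  then have "integrable lborel (\<lambda>\<rho>. (pi * indicator {0..} \<rho>) *\<^sub>R G \<rho>)"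
    unfolding eq by (rule integrable_mult_right)
  then have "integrable (density lborel (\<lambda>\<rho>. ennreal (pi * indicator {0..} \<rho>))) G"
    by (subst integrable_density) auto
  then have int: "integrable lborel (\<lambda>y :: real \<times> real. G ((norm y)\<^sup>2))"
    unfolding distr_lborel_norm_square[symmetric] by (subst (asm) integrable_distr_eq) auto
  have "xray (xray \<phi>') s = (LINT t|lborel. LINT u|lborel. G ((norm (t :: real, u :: real))\<^sup>2))"
    by (simp add: xray_def G_def norm_Pair add.assoc)
  also have "\<dots> = (LINT y|lborel. G ((norm (y :: real \<times> real))\<^sup>2))"
    using lborel_pair.integral_fst'[of "\<lambda>y. G ((norm y)\<^sup>2)"] int by (simp add: lborel_prod)
  also have "\<dots> = (LINT \<rho>|distr (lborel :: (real \<times> real) measure) borel (\<lambda>y. (norm y)\<^sup>2). G \<rho>)"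
    by (subst integral_distr) auto
  also have "\<dots> = (LINT \<rho>|lborel. (pi * indicator {0..} \<rho>) *\<^sub>R G \<rho>)"
    unfolding distr_lborel_norm_square by (subst integral_density) auto
  also have "\<dots> = pi * (LINT \<rho>|lborel. indicator {0..M} \<rho> *\<^sub>R \<phi>' (s + \<rho>))"
    unfolding eq by simp
  also have "(LINT \<rho>|lborel. indicator {0..M} \<rho> *\<^sub>R \<phi>' (s + \<rho>)) = \<phi> (s + M) - \<phi> (s + 0)"
  proof (rule integral_FTC_atLeastAtMost[OF _ _ contM])
    fix \<rho> assume \<rho>: "0 \<le> \<rho>" "\<rho> \<le> M"
    have "((\<lambda>\<rho>. \<phi> (\<rho> + s)) has_real_derivative \<phi>' (\<rho> + s)) (at \<rho> within {0..M})"
      by (rule DERIV_subset[OF profile_derivative_shift[OF deriv \<rho>(1) \<open>s \<ge> 0\<close>]]) auto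
    then show "((\<lambda>\<rho>. \<phi> (s + \<rho>)) has_vector_derivative \<phi>' (s + \<rho>)) (at \<rho> within {0..M})"
      by (simp add: has_real_derivative_iff_has_vector_derivative add.commute)
  qed (use M(1) in simp)
  also have "\<phi> (s + M) = 0" using M(2) \<open>s \<ge> 0\<close> by simp
  finally show ?thesis by simp
qed

section \<open>The weighted transform of radial functions\<close>

text \<open>
  Reflection turns the integral behind \<open>-t\<close> into the integral ahead of \<open>t\<close>, and together with the
  integral behind \<open>t\<close> it covers the line.
\<close>

lemma half_line_integrals_even:
  fixes f :: "real \<Rightarrow> real"
  assumes "integrable lborel f" "\<And>s. f (- s) = f s"
  shows "(LINT s:{0..}|lborel. f (t - s)) + (LINT s:{0..}|lborel. f (- t - s)) = (LINT s|lborel. f s)"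
proof -
  have int: "integrable lborel (\<lambda>s. f (t - s))"
    using lborel_integrable_real_affine[OF assms(1), of "-1" t] by simp
  have "f (- t - s) = f (t + s)" for s
    using assms(2)[of "t + s"] by simp
  then have "(LINT s:{0..}|lborel. f (- t - s)) = (LINT s:{0..}|lborel. f (t + s))"
    by simp
  also have "\<dots> = (LINT s:{..0}|lborel. f (t - s))"
    by (subst set_integral_reflect) (simp add: atMost_def)
  finally have "(LINT s:{0..}|lborel. f (t - s)) + (LINT s:{0..}|lborel. f (- t - s)) =
      (LINT s|lborel. indicator {0..} s *\<^sub>R f (t - s) + indicator {..0} s *\<^sub>R f (t - s))"
    unfolding set_lebesgue_integral_def
    by (simp add: Bochner_Integration.integral_add integrable_mult_indicator[OF _ int] del: scaleR_conv_of_real real_scaleR_def)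
  also have "\<dots> = (LINT s|lborel. f (t - s))"
  proof (rule integral_cong_AE)
    show "AE s in lborel. indicator {0..} s *\<^sub>R f (t - s) + indicator {..0} s *\<^sub>R f (t - s) = f (t - s)"
      using AE_lborel_singleton[of 0] by eventually_elim (auto split: split_indicator)
  qed (use int in \<open>auto intro!: borel_measurable_integrable\<close>)
  also have "\<dots> = (LINT s|lborel. f s)"
    using lborel_integral_real_affine[of "-1" f t] by simp
  finally show ?thesis .
qed

text \<open>
  Averaging the left-hand side over \<open>t \<mapsto> -t\<close> leaves the factor \<open>a(t)\<close> unchanged and replaces the
  half-line integral by half of the integral over the line.
\<close>

lemma half_line_weight_even:
  fixes f a :: "real \<Rightarrow> real"
  assumes f: "integrable lborel f" "\<And>s. f (- s) = f s"
    and a: "integrable lborel a" "\<And>s. a (- s) = a s"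
  shows "(LINT t|lborel. (LINT s:{0..}|lborel. f (t - s)) * a t) =
    1 / 2 * (LINT t|lborel. f t) * (LINT t|lborel. a t)"
proof -
  define G where "G t = (LINT s:{0..}|lborel. f (t - s))" for t
  have fm [measurable]: "f \<in> borel_measurable borel"
    using f(1) by (simp add: integrable_iff_bounded)
  have Gm [measurable]: "G \<in> borel_measurable borel"
    unfolding G_def set_lebesgue_integral_def by measurable
  \<comment> \<open>The weight is bounded, so its product with the integrable function \<open>a\<close> is integrable.\<close>
  have "norm (G t) \<le> (LINT s|lborel. norm (f s))" for t
  proof -
    have int: "integrable lborel (\<lambda>s. norm (f (t - s)))"
      using lborel_integrable_real_affine[OF f(1), of "-1" t] by simp
    have "norm (G t) \<le> (LINT s|lborel. norm (indicator {0..} s *\<^sub>R f (t - s)))"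
      unfolding G_def set_lebesgue_integral_def by (rule integral_norm_bound)
    also have "\<dots> \<le> (LINT s|lborel. norm (f (t - s)))"
      by (rule integral_mono'[OF int]) (auto split: split_indicator)
    also have "\<dots> = (LINT s|lborel. norm (f s))"
      using lborel_integral_real_affine[of "-1" "\<lambda>s. norm (f s)" t] by simp
    finally show ?thesis .
  qed
  then have intG: "integrable lborel (\<lambda>t. G t * a t)"
    using a(1)
    by (intro Bochner_Integration.integrable_bound[OF integrable_mult_right[OF integrable_norm[OF a(1)]],
          of _ "LINT s|lborel. norm (f s)"])
      (auto simp: abs_mult intro!: mult_right_mono)
  have intG': "integrable lborel (\<lambda>t. G (- t) * a t)"
    using lborel_integrable_real_affine[OF intG, of "-1" 0] by (simp add: a(2))
  have "(LINT t|lborel. G t * a t) = (LINT t|lborel. G (- t) * a t)"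
    using lborel_integral_real_affine[of "-1" "\<lambda>t. G t * a t" 0] by (simp add: a(2))
  then have "2 * (LINT t|lborel. G t * a t) = (LINT t|lborel. G t * a t + G (- t) * a t)"
    using intG intG' by simp
  also have "\<dots> = (LINT t|lborel. (LINT s|lborel. f s) * a t)"
    using half_line_integrals_even[OF f] by (simp add: G_def flip: distrib_right)
  also have "\<dots> = (LINT s|lborel. f s) * (LINT t|lborel. a t)"
    by simp
  finally show ?thesis unfolding G_def by simp
qed

text \<open>
  Pythagoras: \<open>|x|\<^sup>2 - (x \<bullet> \<theta>)\<^sup>2\<close> is the squared distance of the line from the origin, and
  \<open>x \<bullet> \<theta> + t\<close> is the arc length from the closest point.
\<close>

lemma norm_line_square:
  fixes x \<theta> :: "'a :: real_inner"
  assumes "norm \<theta> = 1"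
  shows "(norm (x + t *\<^sub>R \<theta>))\<^sup>2 = ((norm x)\<^sup>2 - (x \<bullet> \<theta>)\<^sup>2) + (x \<bullet> \<theta> + t)\<^sup>2"
proof -
  have "\<theta> \<bullet> \<theta> = 1" using assms by (simp add: dot_square_norm)
  then have "(x + t *\<^sub>R \<theta>) \<bullet> (x + t *\<^sub>R \<theta>) = (x \<bullet> x - (x \<bullet> \<theta>)\<^sup>2) + (x \<bullet> \<theta> + t)\<^sup>2"
    by (simp add: inner_add_left inner_add_right inner_commute power2_eq_square algebra_simps)
  then show ?thesis by (simp only: power2_norm_eq_inner)
qed

lemma line_distance_nonneg:
  fixes x \<theta> :: "'a :: real_inner"
  assumes "norm \<theta> = 1"
  shows "(norm x)\<^sup>2 - (x \<bullet> \<theta>)\<^sup>2 \<ge> 0"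
  using power_mono[OF Cauchy_Schwarz_ineq2[of x \<theta>], of 2] assms by simp

lemma xray_radial:
  fixes x \<theta> :: "'a :: real_inner"
  assumes "norm \<theta> = 1"
  shows "(LINT t|lborel. \<phi> ((norm (x + t *\<^sub>R \<theta>))\<^sup>2)) = xray \<phi> ((norm x)\<^sup>2 - (x \<bullet> \<theta>)\<^sup>2)"
  using lborel_integral_real_affine[of 1 "\<lambda>t. \<phi> ((norm x)\<^sup>2 - (x \<bullet> \<theta>)\<^sup>2 + t\<^sup>2)" "x \<bullet> \<theta>"]
  by (simp add: xray_def norm_line_square[OF assms])

lemma weighted_xray_radial:
  fixes x \<theta> :: plane
  assumes "profile \<phi>" "profile \<alpha>" and \<theta>: "norm \<theta> = 1"
  defines "q \<equiv> (norm x)\<^sup>2 - (x \<bullet> \<theta>)\<^sup>2"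
  shows "weighted_xray (flip (beam (\<lambda>y. \<phi> ((norm y)\<^sup>2)))) (\<lambda>y. \<alpha> ((norm y)\<^sup>2)) x \<theta> =
    1 / 2 * xray \<phi> q * xray \<alpha> q"
proof -
  have "q \<ge> 0" unfolding q_def by (rule line_distance_nonneg[OF \<theta>])
  define c where "c = x \<bullet> \<theta>"
  define F where "F t = \<phi> (q + t\<^sup>2)" for t
  define A where "A t = \<alpha> (q + t\<^sup>2)" for t
  have upstream: "\<phi> ((norm (x + t *\<^sub>R \<theta> + s *\<^sub>R - \<theta>))\<^sup>2) = F (c + t - s)" for t s
  proof -
    have "x + t *\<^sub>R \<theta> + s *\<^sub>R - \<theta> = x + (t - s) *\<^sub>R \<theta>"
      by (simp add: algebra_simps)
    then show ?thesis
      by (simp only: norm_line_square[OF \<theta>] F_def q_def c_def add_diff_eq)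
  qed
  have "weighted_xray (flip (beam (\<lambda>y. \<phi> ((norm y)\<^sup>2)))) (\<lambda>y. \<alpha> ((norm y)\<^sup>2)) x \<theta> =
      (LINT t|lborel. (LINT s:{0..}|lborel. F (c + t - s)) * A (c + t))"
    unfolding weighted_xray_def flip_def beam_def upstream
    by (simp add: A_def norm_line_square[OF \<theta>] q_def c_def)
  also have "\<dots> = (LINT t|lborel. (LINT s:{0..}|lborel. F (t - s)) * A t)"
    using lborel_integral_real_affine[of 1 "\<lambda>t. (LINT s:{0..}|lborel. F (t - s)) * A t" c] by simp
  also have "\<dots> = 1 / 2 * (LINT t|lborel. F t) * (LINT t|lborel. A t)"
    by (rule half_line_weight_even)
      (use integrable_profile[OF assms(1) \<open>q \<ge> 0\<close>] integrable_profile[OF assms(2) \<open>q \<ge> 0\<close>]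
        in \<open>simp_all add: F_def[abs_def] A_def[abs_def]\<close>)
  finally show ?thesis by (simp add: xray_def F_def A_def)
qed

section \<open>The Abel integral\<close>

text \<open>
  Substitute \<open>p = \<surd>(r\<^sup>2 + u\<^sup>2)\<close> with \<open>u > 0\<close>: the factor \<open>1 / u\<close> from the kernel cancels against
  \<open>p dp = u du\<close>, which leaves twice the integral of \<open>\<psi>(r\<^sup>2 + u\<^sup>2)\<close> over the half line.
\<close>

lemma abel_substitution:
  assumes "profile \<psi>" "r \<ge> 0"
  defines "F \<equiv> \<lambda>p. (p\<^sup>2 - r\<^sup>2) powr (- 1 / 2) * (2 * p * \<psi> (p\<^sup>2))"
  shows "set_integrable lborel {r<..} F" "(LINT p:{r<..}|lborel. F p) = xray \<psi> (r\<^sup>2)"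
proof -
  let ?K = "\<lambda>u. \<psi> (r\<^sup>2 + u\<^sup>2)"
  let ?g = "\<lambda>u. sqrt (r\<^sup>2 + u\<^sup>2)"
  let ?g' = "\<lambda>u. u / sqrt (r\<^sup>2 + u\<^sup>2)"
  \<comment> \<open>The change of variables theorem speaks of absolute integrability for the completed measure.\<close>
  have lebesgue_iff: "h absolutely_integrable_on S \<longleftrightarrow> set_integrable lborel S h"
    if "continuous_on S h" "S \<in> sets borel" for h :: "real \<Rightarrow> real" and S
  proof -
    have "(\<lambda>x. indicator S x *\<^sub>R h x) \<in> borel_measurable lborel"
      using borel_measurable_continuous_on_indicator[OF that(2,1)] by simp
    then show ?thesis
      unfolding set_integrable_def by (rule integrable_completion)
  qed
  have pos: "r\<^sup>2 + u\<^sup>2 > 0" if "u > 0" for u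
    using that by (simp add: add_nonneg_pos)
  have intK: "integrable lborel ?K"
    using integrable_profile[OF assms(1)] by simp
  have "2 * (LINT u:{0..}|lborel. ?K u) = xray \<psi> (r\<^sup>2)"
    using half_line_integrals_even[OF intK, of 0] by (simp add: xray_def)
  moreover have "(LINT u:{0..}|lborel. ?K u) = (LINT u:{0<..}|lborel. ?K u)"
    unfolding set_lebesgue_integral_def
  proof (rule integral_cong_AE)
    show "AE u in lborel. indicator {0..} u *\<^sub>R ?K u = indicator {0<..} u *\<^sub>R ?K u"
      using AE_lborel_singleton[of 0] by eventually_elim (auto split: split_indicator)
  qed (use borel_measurable_integrable[OF intK] in measurable)
  ultimately have half: "(LINT u:{0<..}|lborel. 2 * ?K u) = xray \<psi> (r\<^sup>2)"
    by simp
  have intK2: "set_integrable lborel {0<..} (\<lambda>u. 2 * ?K u)"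
    unfolding set_integrable_def
    by (intro integrable_mult_indicator integrable_mult_right intK) simp
  have contK: "continuous_on {0<..} (\<lambda>u. 2 * ?K u)"
    by (intro continuous_intros continuous_on_profile_compose[OF assms(1)]) simp
  have transform: "\<bar>?g' u\<bar> * F (?g u) = 2 * ?K u" if "u \<in> {0<..}" for u
    using that pos[of u] by (simp add: F_def powr_minus powr_half_sqrt field_simps)
  have abs: "(\<lambda>u. \<bar>?g' u\<bar> * F (?g u)) absolutely_integrable_on {0<..}"
    using lebesgue_iff[OF contK] intK2 transform
    by (subst set_integrable_cong[where f' = "\<lambda>u. 2 * ?K u"]) auto
  have int: "integral {0<..} (\<lambda>u. \<bar>?g' u\<bar> * F (?g u)) = xray \<psi> (r\<^sup>2)"
  proof -
    have "integral {0<..} (\<lambda>u. \<bar>?g' u\<bar> * F (?g u)) = integral {0<..} (\<lambda>u. 2 * ?K u)"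
      by (rule integral_cong) (rule transform)
    also have "\<dots> = xray \<psi> (r\<^sup>2)"
      using set_borel_integral_eq_integral(2)[OF intK2] half by simp
    finally show ?thesis .
  qed
  have image: "?g ` {0<..} = {r<..}"
  proof (intro equalityI subsetI)
    fix p assume "p \<in> ?g ` {0<..}"
    then obtain u where u: "u > 0" "p = ?g u" by auto
    then have "r\<^sup>2 < r\<^sup>2 + u\<^sup>2" by simp
    then show "p \<in> {r<..}"
      using u(2) real_less_rsqrt by simp
  next
    fix p assume "p \<in> {r<..}"
    then have p: "r < p" by simp
    then have "r\<^sup>2 < p\<^sup>2" using \<open>r \<ge> 0\<close> by (intro power_strict_mono) auto
    then have "p = ?g (sqrt (p\<^sup>2 - r\<^sup>2))" "sqrt (p\<^sup>2 - r\<^sup>2) \<in> {0<..}"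
      using p \<open>r \<ge> 0\<close> by auto
    then show "p \<in> ?g ` {0<..}" by (rule image_eqI)
  qed
  have "F absolutely_integrable_on (?g ` {0<..}) \<and> integral (?g ` {0<..}) F = xray \<psi> (r\<^sup>2)"
  proof (rule iffD1[OF has_absolute_integral_change_of_variables_1'])
    show "(?g has_real_derivative ?g' u) (at u within {0<..})" if "u \<in> {0<..}" for u
      using that pos[of u] by (auto intro!: derivative_eq_intros simp: field_simps)
    show "inj_on ?g {0<..}"
      by (auto simp: inj_on_def)
    show "(\<lambda>u. \<bar>?g' u\<bar> * F (?g u)) absolutely_integrable_on {0<..} \<and>
        integral {0<..} (\<lambda>u. \<bar>?g' u\<bar> * F (?g u)) = xray \<psi> (r\<^sup>2)"
      using abs int by blast
  qed simp
  then have F: "F absolutely_integrable_on {r<..}" "integral {r<..} F = xray \<psi> (r\<^sup>2)"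
    unfolding image by blast+
  have "continuous_on {r<..} F"
    unfolding F_def
  proof (intro continuous_intros continuous_on_profile_compose[OF assms(1)])
    show "\<forall>p\<in>{r<..}. p\<^sup>2 - r\<^sup>2 \<noteq> 0"
      using \<open>r \<ge> 0\<close> by (auto dest: power_strict_mono[of r _ 2])
  qed simp
  then show "set_integrable lborel {r<..} F"
    using F(1) lebesgue_iff by simp
  from set_borel_integral_eq_integral(2)[OF this] show "(LINT p:{r<..}|lborel. F p) = xray \<psi> (r\<^sup>2)"
    using F(2) by simp
qed

section \<open>Infinitely many radial bump functions\<close>

text \<open>
  The classical flat function \<open>exp(-1/t)\<close>, together with its products with negative powers of \<open>t\<close>,
  whose linear combinations are closed under differentiation.
\<close>

definition flat :: "nat \<Rightarrow> real \<Rightarrow> real" where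
  "flat n t = (if t \<le> 0 then 0 else inverse t ^ n / exp (inverse t))"

lemma flat_tendsto_0: "(flat n \<longlongrightarrow> 0) (at 0)"
proof (rule filterlim_split_at_real)
  have "eventually (\<lambda>t. flat n t = 0) (at_left 0)"
    unfolding eventually_at_left_field flat_def by (intro exI[of _ "-1"]) auto
  then show "(flat n \<longlongrightarrow> 0) (at_left 0)"
    by (rule tendsto_eventually)
  have "((\<lambda>t. inverse t ^ n / exp (inverse t)) \<longlongrightarrow> 0) (at_right (0::real))"
    by (rule filterlim_compose[OF tendsto_power_div_exp_0 filterlim_inverse_at_top_right])
  moreover have "eventually (\<lambda>t. inverse t ^ n / exp (inverse t) = flat n t) (at_right 0)"
    unfolding eventually_at_right_field flat_def by (intro exI[of _ 1]) auto
  ultimately show "(flat n \<longlongrightarrow> 0) (at_right 0)"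
    by (rule Lim_transform_eventually)
qed

lemma flat_has_derivative:
  "(flat n has_real_derivative (- real n) * flat (n + 1) t + 1 * flat (n + 2) t) (at t)"
proof -
  consider "t < 0" | "t = 0" | "t > 0" by linarith
  then show ?thesis
  proof cases
    case 1
    have "(flat n has_real_derivative 0) (at t)"
      by (rule has_field_derivative_transform_within_open[of "\<lambda>_. 0" 0 t "{..<0}"])
        (use 1 in \<open>auto simp: flat_def\<close>)
    then show ?thesis using 1 by (simp add: flat_def)
  next
    case 2
    have "(\<lambda>y. (flat n y - flat n 0) / (y - 0)) = flat (n + 1)"
      by (auto simp: fun_eq_iff flat_def divide_simps)
    then have "(flat n has_real_derivative 0) (at 0)"
      using flat_tendsto_0[of "n + 1"] by (simp add: has_field_derivative_iff)
    then show ?thesis using 2 by (simp add: flat_def)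
  next
    case 3
    have inv: "(inverse has_real_derivative - (inverse t ^ Suc (Suc 0))) (at t)"
      by (rule DERIV_inverse) (use 3 in simp)
    have pow: "((\<lambda>t. inverse t ^ n) has_real_derivative - real n * inverse t ^ (n + 1)) (at t)"
      using DERIV_power[OF inv, of n] by (cases n) (simp_all add: algebra_simps)
    have ex: "((\<lambda>t. exp (- inverse t)) has_real_derivative exp (- inverse t) * inverse t ^ 2) (at t)"
      using DERIV_fun_exp[OF DERIV_minus[OF inv]] by (simp add: numeral_2_eq_2)
    have "((\<lambda>t. inverse t ^ n * exp (- inverse t)) has_real_derivative
        (- real n) * (inverse t ^ (n + 1) * exp (- inverse t)) + inverse t ^ (n + 2) * exp (- inverse t)) (at t)"
      by (rule DERIV_cong[OF DERIV_mult[OF pow ex]]) (simp add: algebra_simps power_add power2_eq_square)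
    then have "((\<lambda>t. inverse t ^ n / exp (inverse t)) has_real_derivative
        (- real n) * flat (n + 1) t + 1 * flat (n + 2) t) (at t)"
      using 3 by (simp add: flat_def exp_minus divide_inverse)
    then show ?thesis
      by (rule has_field_derivative_transform_within_open[of _ _ t "{0<..}"])
        (use 3 in \<open>auto simp: flat_def\<close>)
  qed
qed

lemma smooth_on_flat: "smooth_on UNIV (flat n)"
proof -
  let ?X = "\<lambda>P. \<exists>c n. P = (\<lambda>t. c * flat n t)"
  have X: "?X (\<lambda>t. c * flat n t)" for c n
    by (rule exI[of _ c], rule exI[of _ n], rule refl)
  have "smooth_on UNIV (\<lambda>t. 1 * flat n t)"
  proof (rule smooth_on_coinduct_upto_sums[of ?X, OF X])
    fix P assume "?X P"
    then obtain c n where P: "P = (\<lambda>t. c * flat n t)" by (elim exE)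
    let ?P' = "\<lambda>t. (c * (- real n)) * flat (n + 1) t + c * flat (n + 2) t"
    have "\<forall>t\<in>UNIV. (P has_real_derivative ?P' t) (at t)"
      unfolding P
      by (intro ballI DERIV_cong[OF DERIV_cmult[OF flat_has_derivative]]) (simp add: algebra_simps)
    moreover have "sum_closure ?X ?P'"
      by (rule sum_closure_add[OF sum_closure_base[of ?X, OF X] sum_closure_base[of ?X, OF X]])
    ultimately show "\<exists>P'. (\<forall>t\<in>UNIV. (P has_real_derivative P' t) (at t)) \<and> sum_closure ?X P'"
      by (intro exI[of _ ?P'] conjI)
  qed
  then show ?thesis by simp
qed

definition bump :: "nat \<Rightarrow> real \<Rightarrow> real" where
  "bump i s = flat 0 (s - i) * flat 0 (i + 1 - s)"

lemma bump_eq_0_iff: "bump i s = 0 \<longleftrightarrow> s \<le> i \<or> s \<ge> i + 1"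
  by (auto simp: bump_def flat_def)

lemma profile_bump: "profile (bump i)"
proof -
  have "smooth_on {0..} (\<lambda>s. flat 0 (1 * s + - real i) * flat 0 (- 1 * s + (i + 1)))"
    by (intro smooth_on_mult smooth_on_compose_affine smooth_on_flat)
  then have "smooth_on {0..} (bump i)"
    by (rule smooth_on_cong) (simp add: bump_def algebra_simps)
  moreover have "\<forall>s\<ge>real i + 1. bump i s = 0" by (simp add: bump_eq_0_iff)
  ultimately show ?thesis unfolding profile_def by blast
qed

text \<open>
  The point \<open>y i\<close> lies in the annulus \<open>i < |x|\<^sup>2 < i + 1\<close>, so evaluating the first component there
  vanishes on all pairs but the one with index \<open>i\<close>. The pairs are therefore linearly independent,
  whatever their second components are.
\<close>

lemma infinite_dimensional_bumps:
  fixes V :: "((plane \<Rightarrow> real) \<times> ('b \<Rightarrow> real)) set"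
  assumes "\<And>i. ((\<lambda>x. bump i ((norm x)\<^sup>2)), h i) \<in> V"
  shows "infinite_dimensional V"
  unfolding infinite_dimensional_def
proof
  assume "\<exists>B. finite B \<and> V \<subseteq> fun_pair.span B"
  then obtain B where B: "finite B" "V \<subseteq> fun_pair.span B" by (elim exE conjE)
  define u where "u i = ((\<lambda>x :: plane. bump i ((norm x)\<^sup>2)), h i)" for i
  define y where "y i = sqrt (real i + 1 / 2) *\<^sub>R (axis 1 1 :: plane)" for i
  have y: "fst (u j) (y i) = 0 \<longleftrightarrow> j \<noteq> i" for i j
    by (simp add: u_def y_def power_mult_distrib bump_eq_0_iff norm_axis_1) linarith
  have inj: "inj u"
    by (rule injI) (metis y)
  have "fun_pair.independent (range u)"
    unfolding fun_pair.dependent_def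
  proof (intro notI, elim bexE)
    fix v assume "v \<in> range u" and v: "v \<in> fun_pair.span (range u - {v})"
    then obtain i where i: "v = u i" by blast
    have "fun_pair.subspace {w :: (plane \<Rightarrow> real) \<times> ('b \<Rightarrow> real). fst w (y i) = 0}"
      by (auto simp: fun_pair.subspace_def scale_pair_def)
    moreover have "range u - {v} \<subseteq> {w. fst w (y i) = 0}"
      using y by (auto simp: i)
    ultimately have "fun_pair.span (range u - {v}) \<subseteq> {w. fst w (y i) = 0}"
      by (intro fun_pair.span_minimal)
    with v have "fst (u i) (y i) = 0" unfolding i by blast
    then show False using y by blast
  qed
  moreover have "range u \<subseteq> fun_pair.span B"
    using assms B(2) by (auto simp: u_def)
  ultimately have "finite (range u)"
    using fun_pair.independent_span_bound[OF B(1)] by blast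
  then show False
    using inj range_inj_infinite by blast
qed


section \<open>The kernel of the linearization\<close>

lemma perp_on_circle:
  assumes "norm \<omega> = 1"
  shows "norm (perp \<omega>) = 1" "\<omega> \<bullet> perp \<omega> = 0"
  using assms by (simp_all add: norm_eq_1 perp_def inner_vec_def sum_2 power2_eq_square)

lemma line_data_radial:
  assumes "profile \<phi>" "profile \<alpha>" "norm \<omega> = 1"
  shows "line_data (\<lambda>x. \<phi> ((norm x)\<^sup>2)) (\<lambda>x. \<alpha> ((norm x)\<^sup>2)) \<omega> p =
    1 / 2 * xray \<phi> (p\<^sup>2) * xray \<alpha> (p\<^sup>2)"
  using weighted_xray_radial[OF assms(1,2) perp_on_circle(1)[OF assms(3)], of "p *\<^sub>R \<omega>"] assms(3)
  by (simp add: line_data_def perp_on_circle(2) power_mult_distrib)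

lemma radial_source_perturbation: "radial (source_perturbation f da \<omega>)"
  unfolding radial_def source_perturbation_def
  by (rule exI[of _ "\<lambda>r. - (1 / pi) * (LINT p:{r<..}|lborel. abel_integrand f da \<omega> r p)"]) simp

text \<open>
  The weighted transform of \<open>da\<close> is \<open>\<gamma>(p\<^sup>2)\<close> with \<open>\<gamma>\<close> half the product of the two transforms, so the
  source perturbation has the profile \<open>-(1/\<pi>) X \<gamma>'\<close>, and by Abel inversion its X-ray transform
  is again \<open>\<gamma>(p\<^sup>2)\<close>.
\<close>

lemma radial_kernel_pair:
  assumes "profile \<phi>" "profile \<alpha>" "norm \<omega> = 1"
  defines "f \<equiv> \<lambda>x. \<phi> ((norm x)\<^sup>2)" and "da \<equiv> \<lambda>x. \<alpha> ((norm x)\<^sup>2)"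
  shows "line_data f da \<omega> differentiable (at p)"
    and "r \<ge> 0 \<Longrightarrow> set_integrable lborel {r<..} (abel_integrand f da \<omega> r)"
    and "(da, source_perturbation f da \<omega>) \<in> linearized_kernel f"
proof -
  define \<gamma> where "\<gamma> s = 1 / 2 * (xray \<phi> s * xray \<alpha> s)" for s
  have \<gamma>: "profile \<gamma>"
    unfolding \<gamma>_def by (intro profile_cmult profile_mult profile_xray assms(1,2))
  obtain \<gamma>' where \<gamma>': "profile \<gamma>'" "\<forall>s\<ge>0. (\<gamma> has_real_derivative \<gamma>' s) (at s within {0..})"
    using profile_derivative[OF \<gamma>] by (elim exE conjE)
  have data: "line_data f da \<omega> = (\<lambda>p. \<gamma> (p\<^sup>2))"
    using line_data_radial[OF assms(1-3)] by (simp add: fun_eq_iff f_def da_def \<gamma>_def)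
  have deriv: "(line_data f da \<omega> has_real_derivative 2 * p * \<gamma>' (p\<^sup>2)) (at p)" for p
  proof -
    have "((\<lambda>p :: real. p\<^sup>2) has_derivative (\<lambda>v. 2 * p * v)) (at p)"
      by (auto intro!: derivative_eq_intros)
    then have "((\<lambda>p. \<gamma> (p\<^sup>2)) has_derivative (\<lambda>v. \<gamma>' (p\<^sup>2) * (2 * p * v))) (at p)"
      by (rule has_derivative_compose_nonneg[rotated]) (use \<gamma>'(2) in auto)
    moreover have "(\<lambda>v. \<gamma>' (p\<^sup>2) * (2 * p * v)) = (*) (2 * p * \<gamma>' (p\<^sup>2))"
      by (simp add: fun_eq_iff)
    ultimately show ?thesis
      unfolding data has_field_derivative_def by simp
  qed
  show "line_data f da \<omega> differentiable (at p)"
    using deriv[of p] by (simp add: real_differentiable_def exI)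
  have integrand: "abel_integrand f da \<omega> r = (\<lambda>p. (p\<^sup>2 - r\<^sup>2) powr (- 1 / 2) * (2 * p * \<gamma>' (p\<^sup>2)))" for r
    by (simp add: fun_eq_iff abel_integrand_def DERIV_imp_deriv[OF deriv])
  show "set_integrable lborel {r<..} (abel_integrand f da \<omega> r)" if "r \<ge> 0"
    unfolding integrand by (rule abel_substitution(1)[OF \<gamma>'(1) that])
  define \<eta> where "\<eta> s = - (1 / pi) * xray \<gamma>' s" for s
  have \<eta>: "profile \<eta>"
    unfolding \<eta>_def by (intro profile_cmult profile_xray \<gamma>'(1))
  have source: "source_perturbation f da \<omega> = (\<lambda>x. \<eta> ((norm x)\<^sup>2))"
    unfolding source_perturbation_def integrand \<eta>_def
      abel_substitution(2)[OF \<gamma>'(1) norm_ge_zero] by (rule refl)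
  have "linearized_xray f (da, source_perturbation f da \<omega>) x \<theta> = 0" if "norm \<theta> = 1" for x \<theta>
  proof -
    let ?q = "(norm x)\<^sup>2 - (x \<bullet> \<theta>)\<^sup>2"
    have "weighted_xray (flip (beam f)) da x \<theta> = \<gamma> ?q"
      unfolding f_def da_def using weighted_xray_radial[OF assms(1,2) that] by (simp add: \<gamma>_def)
    moreover have "attenuated_xray (\<lambda>_. 0) (source_perturbation f da \<omega>) x \<theta> = xray \<eta> ?q"
      unfolding attenuated_xray_0 source by (rule xray_radial[OF that])
    moreover have "xray \<eta> ?q = - (1 / pi) * xray (xray \<gamma>') ?q"
      unfolding \<eta>_def xray_def by simp
    moreover have "xray (xray \<gamma>') ?q = - pi * \<gamma> ?q"
      by (rule xray_xray[OF \<gamma> \<gamma>' line_distance_nonneg[OF that]])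
    ultimately show ?thesis by (simp add: linearized_xray_def)
  qed
  moreover have "da \<in> test_functions" "source_perturbation f da \<omega> \<in> test_functions"
    unfolding source unfolding da_def
    by (rule radial_profile_test_function[OF assms(2)], rule radial_profile_test_function[OF \<eta>])
  ultimately show "(da, source_perturbation f da \<omega>) \<in> linearized_kernel f"
    by (simp add: linearized_kernel_def)
qed

theorem proposition7p1:
  fixes f :: "real ^ 2 \<Rightarrow> real"
  assumes "f \<in> test_functions" and "radial f"
  shows "infinite_dimensional (linearized_kernel f) \<and>
    (\<forall>da \<in> test_functions. radial da \<longrightarrow>
      (\<forall>\<omega> \<in> sphere 0 1. \<forall>\<omega>' \<in> sphere 0 1. \<forall>p. line_data f da \<omega> p = line_data f da \<omega>' p) \<and>
      (\<forall>\<omega> \<in> sphere 0 1.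
        (\<forall>p. line_data f da \<omega> differentiable (at p)) \<and>
        (\<forall>r\<ge>0. set_integrable lborel {r<..} (abel_integrand f da \<omega> r)) \<and>
        radial (source_perturbation f da \<omega>) \<and>
        (da, source_perturbation f da \<omega>) \<in> linearized_kernel f))"
proof -
  obtain \<phi> where \<phi>: "profile \<phi>" "f = (\<lambda>x. \<phi> ((norm x)\<^sup>2))"
    using radial_test_function_profile[OF assms] by (elim exE conjE)
  have "norm (axis 1 1 :: plane) = 1" by simp
  note bump_pair = radial_kernel_pair(3)[OF \<phi>(1) profile_bump this, folded \<phi>(2)]
  have "infinite_dimensional (linearized_kernel f)"
    by (rule infinite_dimensional_bumps[OF bump_pair])
  moreover have "(\<forall>\<omega> \<in> sphere 0 1. \<forall>\<omega>' \<in> sphere 0 1. \<forall>p. line_data f da \<omega> p = line_data f da \<omega>' p) \<and>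
      (\<forall>\<omega> \<in> sphere 0 1.
        (\<forall>p. line_data f da \<omega> differentiable (at p)) \<and>
        (\<forall>r\<ge>0. set_integrable lborel {r<..} (abel_integrand f da \<omega> r)) \<and>
        radial (source_perturbation f da \<omega>) \<and>
        (da, source_perturbation f da \<omega>) \<in> linearized_kernel f)"
    if da: "da \<in> test_functions" "radial da" for da
  proof -
    obtain \<alpha> where \<alpha>: "profile \<alpha>" "da = (\<lambda>x. \<alpha> ((norm x)\<^sup>2))"
      using radial_test_function_profile[OF da] by (elim exE conjE)
    note pair = radial_kernel_pair[OF \<phi>(1) \<alpha>(1), folded \<phi>(2) \<alpha>(2)]
    show ?thesis
    proof (intro conjI ballI allI impI)
      fix \<omega> \<omega>' :: plane and p :: real
      assume "\<omega> \<in> sphere 0 1" "\<omega>' \<in> sphere 0 1"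
      then show "line_data f da \<omega> p = line_data f da \<omega>' p"
        unfolding \<phi>(2) \<alpha>(2) by (simp add: line_data_radial[OF \<phi>(1) \<alpha>(1)])
    next
      fix \<omega> :: plane
      assume "\<omega> \<in> sphere 0 1"
      then have \<omega>: "norm \<omega> = 1" by simp
      show "line_data f da \<omega> differentiable (at p)" for p
        by (rule pair(1)[OF \<omega>])
      show "set_integrable lborel {r<..} (abel_integrand f da \<omega> r)" if "0 \<le> r" for r
        by (rule pair(2)[OF \<omega> that])
      show "radial (source_perturbation f da \<omega>)"
        by (rule radial_source_perturbation)
      show "(da, source_perturbation f da \<omega>) \<in> linearized_kernel f"
        by (rule pair(3)[OF \<omega>])
    qed
  qed
  ultimately show ?thesis by blast
qed

end
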